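(* Let $m\in\mathbb{N}^*$ and let $s_1,\ldots,s_m\in\mathbb{N}^*$ be integers with $\gcd(s_1,\ldots,s_m)=1$, and let $\hat{s}=\sum_{i=1}^m s_i$. Then $L(s_1,\ldots,s_m)\ge\lceil\log_2(\hat{s})\rceil$.
   Context: $\mathbb{N}^*$ is the set of positive integers; $\lceil a\rceil$ is the least integer not smaller than $a$. A simple second-order cone representation of size $n\ge 1$ of the weighted geometric mean inequality $x_1^{s_1}\cdots x_m^{s_m}\ge x_{m+1}^{\hat{s}}$ is a set of $n$ quadratic inequalities $x_{i_k}x_{j_k}\ge x_{m+k}^2$, $k=1,\ldots,n$, with $i_k,j_k\in\{1,2,\ldots,m+n\}$, such that for all nonnegative reals $x_1,\ldots,x_{m+1}$: $x_1^{s_1}\cdots x_m^{s_m}\ge x_{m+1}^{\hat{s}}$ holds if and only if there exist nonnegative reals $x_{m+2},\ldots,x_{m+n}$ (the $n-1$ auxiliary variables) with $x_{i_k}x_{j_k}\ge x_{m+k}^2$ for all $k=1,\ldots,n$. $L(s_1,\ldots,s_m)$ denotes the minimum size $n$ of a simple second-order cone representation of $x_1^{s_1}\cdots x_m^{s_m}\ge x_{m+1}^{\hat{s}}$. *)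

theory Defs
  imports Complex_Main
begin

text \<open>
  Variables are 1-indexed: a point is a function on the naturals of which only the values at
  \<open>1, \<dots>, m + n\<close> matter, and likewise only \<open>s 1, \<dots>, s m\<close> and \<open>i k, j k\<close> for \<open>1 \<le> k \<le> n\<close> matter.
  Below, \<open>y\<close> is the given point \<open>x\<close> extended by the auxiliary variables \<open>m + 2, \<dots>, m + n\<close>.
\<close>

definition simple_soc_rep ::
  "nat \<Rightarrow> (nat \<Rightarrow> nat) \<Rightarrow> nat \<Rightarrow> (nat \<Rightarrow> nat) \<Rightarrow> (nat \<Rightarrow> nat) \<Rightarrow> bool" where
  "simple_soc_rep m s n i j \<longleftrightarrow>
     1 \<le> n \<and>
     (\<forall>k\<in>{1..n}. i k \<in> {1..m + n} \<and> j k \<in> {1..m + n}) \<and>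
     (\<forall>x :: nat \<Rightarrow> real. (\<forall>l\<in>{1..m + 1}. 0 \<le> x l) \<longrightarrow>
        ((\<Prod>l = 1..m. x l ^ s l) \<ge> x (m + 1) ^ (\<Sum>l = 1..m. s l) \<longleftrightarrow>
         (\<exists>y :: nat \<Rightarrow> real.
            (\<forall>l\<in>{1..m + 1}. y l = x l) \<and>
            (\<forall>l\<in>{m + 2..m + n}. 0 \<le> y l) \<and>
            (\<forall>k\<in>{1..n}. y (i k) * y (j k) \<ge> (y (m + k))\<^sup>2))))"

text \<open>
  The minimum is a genuine one when a representation exists. Otherwise the value is unspecified,
  so a bound on \<open>min_soc_size\<close> is not vacuous: it presupposes existence.
\<close>

definition min_soc_size :: "nat \<Rightarrow> (nat \<Rightarrow> nat) \<Rightarrow> nat" where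
  "min_soc_size m s = (LEAST n. \<exists>i j. simple_soc_rep m s n i j)"

end

theory Submission
  imports Defs "Jordan_Normal_Form.Determinant"
begin

text \<open>
  Write \<open>S\<close> for the sum of the weights. The claim splits into \<open>S \<le> 2 ^ n\<close> for the size \<open>n\<close> of
  every representation, and the existence of some representation, without which the least
  size would not be the size of anything.

  For the bound, pass to logarithms: the constraint \<open>x (i k) * x (j k) \<ge> (x (m + k))\<^sup>2\<close>
  becomes \<open>2 * P (m + k) \<le> P (i k) + P (j k)\<close>, where \<open>P = ln \<circ> x\<close>. Call \<open>P\<close> harmonic if equality
  holds for every \<open>k\<close>. Then both \<open>P\<close> and \<open>-P\<close> yield feasible points, so the inequality that is
  represented holds for both, which forces the equality \<open>(\<Sum>l. s l * P l) = S * P (m + 1)\<close>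
  (lemma \<open>harmonic_potential_weighted_sum\<close>). The harmonic equations are a linear
  system of \<open>n\<close> rows with integer coefficients in the \<open>n\<close> values \<open>P (m + k)\<close>. By Cramer's rule its
  solution is integral once the boundary values \<open>P 1, \<dots>, P m\<close> are multiples of the determinant
  \<open>D\<close>. Taking \<open>P l = D\<close> and zero at the other boundary points gives \<open>s l * D = S * P (m + 1)\<close>, so
  \<open>S\<close> divides \<open>s l * D\<close> for every \<open>l\<close>. The weights are coprime, so \<open>S\<close> divides \<open>D\<close>.

  It remains to see \<open>D \<noteq> 0\<close> and \<open>\<bar>D\<bar> \<le> 2 ^ n\<close>. Each row is a sum of two arcs,
  \<open>2 e\<^sub>k - e\<^sub>i - e\<^sub>j = (e\<^sub>k - e\<^sub>i) + (e\<^sub>k - e\<^sub>j)\<close>, so by multilinearity \<open>D\<close> is a sum of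
  \<open>2 ^ n\<close> determinants of matrices with one arc per row, and each of these is \<open>0\<close> or \<open>\<plusminus>1\<close>
  (lemma \<open>abs_det_arc_matrix_le_1\<close>). Singularity is excluded by the maximum principle, except for
  variables whose successors never lead to the boundary. These are the members of the largest
  set of auxiliary variables that is closed under \<open>i\<close> and \<open>j\<close>; their potential is set to zero,
  which is consistent with their constraints precisely because the set is closed
  (lemma \<open>integer_harmonic_potentials\<close>).

  For existence, choose \<open>d\<close> with \<open>2 ^ d \<ge> S\<close> and multiply both sides by \<open>x (m + 1) ^ (2 ^ d - S)\<close>.
  The result bounds \<open>x (m + 1)\<close> by a geometric mean of \<open>2 ^ d\<close> numbers, which a complete binary
  tree of means of two numbers expresses (lemma \<open>simple_soc_rep_exists\<close>).
\<close>

section \<open>Determinants of arc matrices\<close>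

lemma det_row_single:
  fixes A :: "'a :: comm_ring_1 mat"
  assumes "A \<in> carrier_mat n n" and "i < n"
    and zero: "\<And>l. l < n \<Longrightarrow> l \<noteq> j \<Longrightarrow> A $$ (i, l) = 0"
  shows "det A = (if j < n then A $$ (i, j) * cofactor A i j else 0)"
proof -
  have "det A = (\<Sum>l<n. A $$ (i, l) * cofactor A i l)"
    by (rule laplace_expansion_row[OF assms(1,2)])
  also have "\<dots> = (\<Sum>l<n. if l = j then A $$ (i, j) * cofactor A i j else 0)"
    by (rule sum.cong) (auto simp: zero)
  finally show ?thesis by simp
qed

text \<open>
  An arc matrix has rows \<open>e\<^sub>p - e\<^sub>q\<close>, where \<open>e\<^sub>p = 0\<close> if \<open>p\<close> is not a column index. If every
  row has both its ends among the columns, the entries of each row sum to zero and the matrix is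
  singular. Otherwise some row has at most one nonzero entry, and expansion along it leaves a smaller arc matrix:
  an end in the deleted column turns into an end outside.
\<close>

lemma abs_det_arc_matrix_le_1:
  fixes p q :: "nat \<Rightarrow> nat"
  shows "\<bar>det (mat n n (\<lambda>(k, l). of_bool (l = p k) - of_bool (l = q k)) :: int mat)\<bar> \<le> 1"
proof (induction n arbitrary: p q)
  case 0
  then show ?case by simp
next
  case (Suc n)
  define A :: "int mat" where
    "A = mat (Suc n) (Suc n) (\<lambda>(k, l). of_bool (l = p k) - of_bool (l = q k))"
  have A: "A \<in> carrier_mat (Suc n) (Suc n)" by (simp add: A_def)
  have "\<bar>det A\<bar> \<le> 1"
  proof (cases "\<forall>k<Suc n. p k < Suc n \<and> q k < Suc n")
    case True
    \<comment> \<open>The all-ones vector is in the kernel.\<close>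
    define u :: "int vec" where "u = vec (Suc n) (\<lambda>_. 1)"
    have "A *\<^sub>v u = 0\<^sub>v (Suc n)"
    proof (rule eq_vecI)
      fix k assume "k < dim_vec (0\<^sub>v (Suc n) :: int vec)"
      then have k: "k < Suc n" by simp
      have "(A *\<^sub>v u) $ k = (\<Sum>l<Suc n. of_bool (l = p k) - of_bool (l = q k))"
        using k by (simp add: A_def u_def scalar_prod_def atLeast0LessThan)
      also have "\<dots> = 0"
        using True k by (simp add: sum_subtractf of_bool_def del: sum.lessThan_Suc)
      finally show "(A *\<^sub>v u) $ k = 0\<^sub>v (Suc n) $ k" using k by simp
    qed (simp add: A_def)
    moreover have "u \<in> carrier_vec (Suc n)" by (simp add: u_def)
    moreover have "u \<noteq> 0\<^sub>v (Suc n)"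
    proof
      assume "u = 0\<^sub>v (Suc n)"
      then have "u $ 0 = 0\<^sub>v (Suc n) $ 0" by simp
      then show False by (simp add: u_def)
    qed
    ultimately have "det A = 0" using det_0_iff_vec_prod_zero[OF A] by blast
    then show ?thesis by simp
  next
    case False
    then obtain i where i: "i < Suc n" and "\<not> (p i < Suc n \<and> q i < Suc n)" by blast
    \<comment> \<open>One end is at least \<open>Suc n\<close>, so only the smaller one can be a column.\<close>
    define j where "j = min (p i) (q i)"
    have zero: "A $$ (i, l) = 0" if "l < Suc n" "l \<noteq> j" for l
      using i that \<open>\<not> (p i < Suc n \<and> q i < Suc n)\<close>
      by (auto simp: A_def j_def min_def split: if_splits)
    have det: "det A = (if j < Suc n then A $$ (i, j) * cofactor A i j else 0)"
      by (rule det_row_single[OF A i zero])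
    have "\<bar>cofactor A i j\<bar> \<le> 1" if j: "j < Suc n"
    proof -
      define row where "row k = (if k < i then k else Suc k)" for k
      \<comment> \<open>Deleting column \<open>j\<close> shifts the later columns; the value \<open>n\<close> lies outside the minor.\<close>
      define col where "col l = (if l < j then l else if l = j \<or> l \<ge> Suc n then n else l - 1)" for l
      have col: "(if l < j then l else Suc l) = v \<longleftrightarrow> l = col v" if "l < n" for l v
        using that j by (auto simp: col_def)
      have "mat_delete A i j =
          mat n n (\<lambda>(k, l). of_bool (l = col (p (row k))) - of_bool (l = col (q (row k))))"
        using i j by (intro eq_matI) (simp_all add: mat_delete_def A_def row_def col)
      then have "\<bar>det (mat_delete A i j)\<bar> \<le> 1" using Suc.IH by simp
      then show ?thesis by (simp add: cofactor_def abs_mult power_abs)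
    qed
    moreover have "\<bar>A $$ (i, j)\<bar> \<le> 1" if "j < Suc n"
      using i that by (simp add: A_def of_bool_def)
    ultimately show ?thesis
      unfolding det by (auto simp: abs_mult intro: mult_le_one)
  qed
  then show ?case by (simp add: A_def)
qed

lemma det_row_add:
  fixes A B C :: "'a :: comm_ring_1 mat"
  assumes "A \<in> carrier_mat n n" "B \<in> carrier_mat n n" "C \<in> carrier_mat n n" and t: "t < n"
    and row: "\<And>l. l < n \<Longrightarrow> A $$ (t, l) = B $$ (t, l) + C $$ (t, l)"
    and eq: "\<And>k l. k < n \<Longrightarrow> l < n \<Longrightarrow> k \<noteq> t \<Longrightarrow> A $$ (k, l) = B $$ (k, l) \<and> A $$ (k, l) = C $$ (k, l)"
  shows "det A = det B + det C"
proof -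
  have eqB: "A $$ (k, l) = B $$ (k, l)" and eqC: "A $$ (k, l) = C $$ (k, l)"
    if "k < n" "l < n" "k \<noteq> t" for k l
    using eq that by blast+
  have "mat_delete A t l = mat_delete B t l" if "l < n" for l
    using assms(1-3) that t by (auto intro!: eq_matI eqB simp: mat_delete_def)
  moreover have "mat_delete A t l = mat_delete C t l" if "l < n" for l
    using assms(1-3) that t by (auto intro!: eq_matI eqC simp: mat_delete_def)
  ultimately have "mat_delete A t l = mat_delete B t l" "mat_delete A t l = mat_delete C t l"
    if "l < n" for l
    using that by blast+
  then have "cofactor A t l = cofactor B t l" "cofactor A t l = cofactor C t l" if "l < n" for l
    using that by (simp_all add: cofactor_def)
  then show ?thesis
    unfolding laplace_expansion_row[OF assms(1) t] laplace_expansion_row[OF assms(2) t]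
      laplace_expansion_row[OF assms(3) t] sum.distrib[symmetric]
    by (intro sum.cong) (auto simp: row algebra_simps)
qed

text \<open>
  Rows before \<open>t\<close> are sums of two arcs, the others are single arcs. Splitting row \<open>t\<close> into its two arcs
  writes the determinant for \<open>Suc t\<close> as a sum of two determinants for \<open>t\<close>; the induction
  is over all \<open>f\<close>, since the second of them has \<open>g t\<close> in place of \<open>f t\<close>.
\<close>

lemma abs_det_mixed_arc_matrix_le:
  fixes p f g :: "nat \<Rightarrow> nat"
  assumes "t \<le> n"
  shows "\<bar>det (mat n n (\<lambda>(k, l). of_bool (l = p k) - of_bool (l = f k)
    + (if k < t then of_bool (l = p k) - of_bool (l = g k) else 0)) :: int mat)\<bar> \<le> 2 ^ t"
  using assms
proof (induction t arbitrary: f)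
  case 0
  then show ?case using abs_det_arc_matrix_le_1[of n p f] by simp
next
  case (Suc t)
  define M :: "nat \<Rightarrow> (nat \<Rightarrow> nat) \<Rightarrow> int mat" where
    "M t f = mat n n (\<lambda>(k, l). of_bool (l = p k) - of_bool (l = f k)
      + (if k < t then of_bool (l = p k) - of_bool (l = g k) else 0))" for t f
  have "det (M (Suc t) f) = det (M t f) + det (M t (f(t := g t)))"
    using Suc.prems by (intro det_row_add[where t = t]) (auto simp: M_def)
  moreover have "\<bar>det (M t f)\<bar> \<le> 2 ^ t" "\<bar>det (M t (f(t := g t)))\<bar> \<le> 2 ^ t"
    using Suc.IH Suc.prems unfolding M_def by simp_all
  ultimately have "\<bar>det (M (Suc t) f)\<bar> \<le> 2 ^ Suc t" by simp
  then show ?case by (simp only: M_def)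
qed

text \<open>
  The matrix of the equations saying that the value at each \<open>k\<close> is the mean of the values at \<open>f k\<close>
  and \<open>g k\<close>. Indices \<open>f k \<ge> n\<close> contribute nothing to the row: they stand for points whose
  value is prescribed and belongs on the right-hand side.
\<close>

definition averaging_matrix :: "nat \<Rightarrow> (nat \<Rightarrow> nat) \<Rightarrow> (nat \<Rightarrow> nat) \<Rightarrow> int mat" where
  "averaging_matrix n f g =
     mat n n (\<lambda>(k, l). 2 * of_bool (l = k) - of_bool (l = f k) - of_bool (l = g k))"

lemma averaging_matrix_carrier [simp]: "averaging_matrix n f g \<in> carrier_mat n n"
  by (simp add: averaging_matrix_def)

lemma abs_det_averaging_matrix_le: "\<bar>det (averaging_matrix n f g)\<bar> \<le> 2 ^ n"
proof -
  have "averaging_matrix n f g = mat n n (\<lambda>(k, l). of_bool (l = k) - of_bool (l = f k)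
    + (if k < n then of_bool (l = k) - of_bool (l = g k) else 0))"
    by (auto intro!: eq_matI simp: averaging_matrix_def)
  then show ?thesis using abs_det_mixed_arc_matrix_le[of n n "\<lambda>k. k" f g] by simp
qed

lemma averaging_matrix_mult_vec:
  assumes "v \<in> carrier_vec n" and k: "k < n"
  shows "(averaging_matrix n f g *\<^sub>v v) $ k =
    2 * v $ k - (if f k < n then v $ f k else 0) - (if g k < n then v $ g k else 0)"
proof -
  have "(averaging_matrix n f g *\<^sub>v v) $ k =
      (\<Sum>l<n. (2 * of_bool (l = k) - of_bool (l = f k) - of_bool (l = g k)) * v $ l)"
    using assms by (simp add: averaging_matrix_def scalar_prod_def atLeast0LessThan)
  also have "\<dots> = (\<Sum>l<n. (if l = k then 2 * v $ l else 0) - (if l = f k then v $ l else 0)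
      - (if l = g k then v $ l else 0))"
    by (intro sum.cong) (auto simp: of_bool_def)
  also have "\<dots> = 2 * v $ k - (if f k < n then v $ f k else 0) - (if g k < n then v $ g k else 0)"
    using k by (simp add: sum_subtractf)
  finally show ?thesis .
qed

text \<open>
  The maximum principle: where a kernel vector attains its largest absolute value, so do both
  successors. The indices attaining it thus form a closed set, which contradicts the assumption.
\<close>

lemma det_averaging_matrix_nonzero:
  assumes no_closed: "\<And>S. S \<subseteq> {..<n} \<Longrightarrow> S \<noteq> {} \<Longrightarrow> \<exists>k\<in>S. f k \<notin> S \<or> g k \<notin> S"
  shows "det (averaging_matrix n f g) \<noteq> 0"
proof
  assume "det (averaging_matrix n f g) = 0"
  then obtain v where v: "v \<in> carrier_vec n" "v \<noteq> 0\<^sub>v n"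
    and ker: "averaging_matrix n f g *\<^sub>v v = 0\<^sub>v n"
    using det_0_iff_vec_prod_zero[OF averaging_matrix_carrier] by blast
  define w where "w k = (if k < n then v $ k else 0)" for k
  obtain k0 where k0: "k0 < n" "w k0 \<noteq> 0"
    using v by (auto simp: w_def vec_eq_iff)
  define M where "M = Max ((\<lambda>k. \<bar>w k\<bar>) ` {..<n})"
  define S where "S = {k. k < n \<and> \<bar>w k\<bar> = M}"
  have le: "\<bar>w k\<bar> \<le> M" if "k < n" for k
    using that by (auto simp: M_def intro!: Max_ge)
  have M: "0 < M" using le[OF k0(1)] k0(2) by simp
  have w_le: "\<bar>w k\<bar> \<le> M" for k
    using le[of k] M by (cases "k < n") (auto simp: w_def)
  have in_S: "k \<in> S" if "\<bar>w k\<bar> = M" for k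
    using that M by (auto simp: S_def w_def split: if_splits)
  have "M \<in> (\<lambda>k. \<bar>w k\<bar>) ` {..<n}"
    using k0(1) unfolding M_def by (intro Max_in) auto
  then have "S \<noteq> {}" by (auto simp: S_def)
  then obtain k where k: "k \<in> S" and exit: "f k \<notin> S \<or> g k \<notin> S"
    using no_closed[of S] by (auto simp: S_def)
  have "2 * w k = w (f k) + w (g k)"
    using averaging_matrix_mult_vec[OF v(1), of k f g] k ker by (auto simp: S_def w_def)
  then have "\<bar>w (f k)\<bar> = M \<and> \<bar>w (g k)\<bar> = M"
    using k w_le[of "f k"] w_le[of "g k"] by (auto simp: S_def)
  then show False using exit in_S by blast
qed

text \<open>
  Cramer's rule: \<open>v\<close> is the adjugate matrix applied to \<open>b\<close>. Multiplying the right-hand side by the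
  determinant is what makes the solution integral.
\<close>

lemma averaging_equations_solvable:
  fixes b :: "nat \<Rightarrow> int"
  obtains v :: "nat \<Rightarrow> int" where
    "\<And>k. k < n \<Longrightarrow> 2 * v k = (if f k < n then v (f k) else 0) + (if g k < n then v (g k) else 0)
       + det (averaging_matrix n f g) * b k"
proof -
  let ?A = "averaging_matrix n f g"
  define x where "x = adj_mat ?A *\<^sub>v vec n b"
  have adj: "adj_mat ?A \<in> carrier_mat n n" and "?A * adj_mat ?A = det ?A \<cdot>\<^sub>m 1\<^sub>m n"
    by (rule adj_mat(1,2), simp)+
  then have "?A *\<^sub>v x = (det ?A \<cdot>\<^sub>m 1\<^sub>m n) *\<^sub>v vec n b"
    using assoc_mult_mat_vec[OF averaging_matrix_carrier adj, of "vec n b" f g]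
    by (simp add: x_def)
  also have "\<dots> = det ?A \<cdot>\<^sub>v vec n b"
    by (intro eq_vecI) (auto simp: scalar_prod_def if_distrib if_distribR cong: if_cong)
  finally have *: "?A *\<^sub>v x = det ?A \<cdot>\<^sub>v vec n b" .
  have x: "x \<in> carrier_vec n" using adj by (simp add: x_def)
  show ?thesis
  proof
    fix k assume k: "k < n"
    then have "(?A *\<^sub>v x) $ k = det ?A * b k" unfolding * by simp
    then show "2 * x $ k = (if f k < n then x $ f k else 0) + (if g k < n then x $ g k else 0)
       + det ?A * b k"
      unfolding averaging_matrix_mult_vec[OF x k] by linarith
  qed
qed

section \<open>Harmonic potentials\<close>

text \<open>
  The integer \<open>D\<close> is the same for all boundary values \<open>c\<close>, as it is the determinant of a
  system in which \<open>c\<close> enters only on the right-hand side. The set \<open>C\<close> in the proof is the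
  largest closed set of auxiliary variables, where the potential is made zero: a row of \<open>C\<close> loses its
  successors and becomes \<open>2 * P v = 0\<close>. Any nonempty closed set among the remaining rows could be added
  to \<open>C\<close>, so there is none and the system is regular.
\<close>

lemma integer_harmonic_potentials:
  fixes i j :: "nat \<Rightarrow> nat"
  assumes ij: "\<And>k. k \<in> {1..n} \<Longrightarrow> i k \<in> {1..m + n} \<and> j k \<in> {1..m + n}"
  obtains D :: int where "D \<noteq> 0" and "\<bar>D\<bar> \<le> 2 ^ n"
    and "\<And>c. \<exists>P :: nat \<Rightarrow> int. (\<forall>v\<le>m. P v = D * c v) \<and>
          (\<forall>k\<in>{1..n}. 2 * P (m + k) = P (i k) + P (j k))"
proof
  \<comment> \<open>Variables are numbered from 1, matrix rows from 0: row \<open>k\<close> belongs to the variable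
    \<open>m + 1 + k\<close>, and the value \<open>n\<close> of \<open>f\<close> and \<open>g\<close> stands for a variable without a row.\<close>
  define closed where "closed T \<longleftrightarrow> T \<subseteq> {m + 1..m + n} \<and>
    (\<forall>k\<in>{1..n}. m + k \<in> T \<longrightarrow> i k \<in> T \<and> j k \<in> T)" for T
  define C where "C = \<Union> {T. closed T}"
  have C: "closed C"
    unfolding closed_def
  proof (intro conjI ballI impI)
    show "C \<subseteq> {m + 1..m + n}" unfolding C_def closed_def by blast
    fix k assume k: "k \<in> {1..n}" and "m + k \<in> C"
    then obtain T where T: "closed T" "m + k \<in> T" unfolding C_def by blast
    then have "T \<subseteq> C" unfolding C_def by blast
    moreover have "i k \<in> T \<and> j k \<in> T" using T k unfolding closed_def by blast
    ultimately show "i k \<in> C" "j k \<in> C" by blast+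
  qed
  have C_range: "C \<subseteq> {m + 1..m + n}" using C unfolding closed_def by blast
  have C_step: "i k \<in> C \<and> j k \<in> C" if "k \<in> {1..n}" "m + k \<in> C" for k
    using C that unfolding closed_def by blast
  define idx where "idx k v = (if m + 1 + k \<in> C \<or> v \<le> m then n else v - (m + 1))" for k v
  define f where "f k = idx k (i (k + 1))" for k
  define g where "g k = idx k (j (k + 1))" for k
  define D where "D = det (averaging_matrix n f g)"
  show "D \<noteq> 0"
    unfolding D_def
  proof (rule det_averaging_matrix_nonzero, rule ccontr)
    fix S assume S: "S \<subseteq> {..<n}" "S \<noteq> {}" and "\<not> (\<exists>k\<in>S. f k \<notin> S \<or> g k \<notin> S)"
    then have fg: "f k \<in> S" "g k \<in> S" if "k \<in> S" for k using that by auto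
    have idx: "m + 1 + k \<notin> C \<and> v = m + 1 + idx k v" if "idx k v \<in> S" for k v
      using that S by (auto simp: idx_def split: if_splits)
    have "closed (C \<union> (\<lambda>k. m + 1 + k) ` S)"
      unfolding closed_def
    proof (intro conjI ballI impI)
      show "C \<union> (\<lambda>k. m + 1 + k) ` S \<subseteq> {m + 1..m + n}"
        using S C_range by auto
      fix k assume k: "k \<in> {1..n}" and "m + k \<in> C \<union> (\<lambda>k. m + 1 + k) ` S"
      then consider "m + k \<in> C" | "k - 1 \<in> S" by auto
      then have "(i k \<in> C \<and> j k \<in> C) \<or>
          (i k \<in> (\<lambda>k. m + 1 + k) ` S \<and> j k \<in> (\<lambda>k. m + 1 + k) ` S)"
      proof cases
        case 1
        then show ?thesis using C_step[OF k] by blast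
      next
        case 2
        then show ?thesis
          using fg[OF 2] idx[of "k - 1" "i k"] idx[of "k - 1" "j k"] k
          unfolding f_def g_def by auto
      qed
      then show "i k \<in> C \<union> (\<lambda>k. m + 1 + k) ` S" "j k \<in> C \<union> (\<lambda>k. m + 1 + k) ` S" by auto
    qed
    then have "(\<lambda>k. m + 1 + k) ` S \<subseteq> C" unfolding C_def by blast
    moreover obtain k where "k \<in> S" using S by blast
    ultimately show False using idx[of k "i (k + 1)"] fg[of k] by (auto simp: f_def)
  qed
  show "\<bar>D\<bar> \<le> 2 ^ n" unfolding D_def by (rule abs_det_averaging_matrix_le)
  fix c :: "nat \<Rightarrow> int"
  define boundary where "boundary v = (if v \<le> m then c v else 0)" for v
  obtain N :: "nat \<Rightarrow> int" where
    N: "\<And>k. k < n \<Longrightarrow> 2 * N k = (if f k < n then N (f k) else 0) + (if g k < n then N (g k) else 0)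
      + D * (if m + 1 + k \<in> C then 0 else boundary (i (k + 1)) + boundary (j (k + 1)))"
    using averaging_equations_solvable[where n = n and f = f and g = g and
        b = "\<lambda>k. if m + 1 + k \<in> C then 0 else boundary (i (k + 1)) + boundary (j (k + 1))"]
    unfolding D_def by blast
  define P where "P v = (if v \<le> m then D * c v else N (v - (m + 1)))" for v
  have P_C: "P v = 0" if "v \<in> C" for v
  proof -
    have "m + 1 \<le> v" "v \<le> m + n" using C_range that by auto
    moreover define k where "k = v - (m + 1)"
    ultimately have k: "v = m + 1 + k" "k < n" by linarith+
    then show ?thesis using N[of k] that by (simp add: P_def f_def g_def idx_def)
  qed
  have P_out: "P v = (if idx k v < n then N (idx k v) else 0) + D * boundary v"
    if "v \<in> {1..m + n}" "m + 1 + k \<notin> C" for k v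
    using that by (auto simp: P_def idx_def boundary_def)
  have "2 * P (m + k) = P (i k) + P (j k)" if k: "k \<in> {1..n}" for k
  proof (cases "m + k \<in> C")
    case True
    then have "i k \<in> C" "j k \<in> C" using C_step[OF k] by blast+
    then show ?thesis using True by (simp add: P_C)
  next
    case False
    obtain q where q: "k = q + 1" "q < n" using k by (cases k) auto
    have "2 * P (m + k) = 2 * N q" using q by (simp add: P_def)
    also have "\<dots> = ((if f q < n then N (f q) else 0) + D * boundary (i k))
        + ((if g q < n then N (g q) else 0) + D * boundary (j k))"
      using N[of q] q False by (simp add: algebra_simps)
    also have "\<dots> = P (i k) + P (j k)"
      using P_out[of "i k" q] P_out[of "j k" q] ij[OF k] q False by (simp add: f_def g_def)
    finally show ?thesis .
  qed
  then show "\<exists>P. (\<forall>v\<le>m. P v = D * c v) \<and> (\<forall>k\<in>{1..n}. 2 * P (m + k) = P (i k) + P (j k))"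
    by (intro exI[of _ P]) (simp add: P_def)
qed

text \<open>
  Both \<open>exp \<circ> P\<close> and \<open>exp \<circ> (-P)\<close> satisfy all the quadratic constraints, with equality. The
  logarithm of the represented inequality, applied to the two points, gives the two directions.
\<close>

lemma harmonic_potential_weighted_sum:
  fixes P :: "nat \<Rightarrow> real"
  assumes rep: "simple_soc_rep m s n i j"
    and harmonic: "\<And>k. k \<in> {1..n} \<Longrightarrow> 2 * P (m + k) = P (i k) + P (j k)"
  shows "(\<Sum>l = 1..m. real (s l) * P l) = real (\<Sum>l = 1..m. s l) * P (m + 1)"
proof -
  have ge: "(\<Sum>l = 1..m. real (s l) * Q l) \<ge> real (\<Sum>l = 1..m. s l) * Q (m + 1)"
    if Q: "\<And>k. k \<in> {1..n} \<Longrightarrow> 2 * Q (m + k) = Q (i k) + Q (j k)" for Q :: "nat \<Rightarrow> real"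
  proof -
    define x where "x v = exp (Q v)" for v
    have "x (i k) * x (j k) \<ge> (x (m + k))\<^sup>2" if "k \<in> {1..n}" for k
      using Q[OF that] by (simp add: x_def flip: exp_add exp_double)
    moreover have "\<forall>l\<in>{1..m + 1}. 0 \<le> x l" "\<forall>l\<in>{m + 2..m + n}. 0 \<le> x l"
      by (simp_all add: x_def)
    ultimately have "(\<Prod>l = 1..m. x l ^ s l) \<ge> x (m + 1) ^ (\<Sum>l = 1..m. s l)"
      using rep unfolding simple_soc_rep_def by blast
    also have "(\<Prod>l = 1..m. x l ^ s l) = exp (\<Sum>l = 1..m. real (s l) * Q l)"
      by (simp add: x_def exp_sum exp_of_nat_mult)
    also have "x (m + 1) ^ (\<Sum>l = 1..m. s l) = exp (real (\<Sum>l = 1..m. s l) * Q (m + 1))"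
      by (simp only: x_def exp_of_nat_mult)
    finally show ?thesis by (simp only: exp_le_cancel_iff)
  qed
  have "2 * - P (m + k) = - P (i k) + - P (j k)" if "k \<in> {1..n}" for k
    using harmonic[OF that] by simp
  from ge[of P, OF harmonic] ge[of "\<lambda>v. - P v", OF this] show ?thesis
    by (simp add: sum_negf)
qed

lemma sum_weights_le_power_size:
  assumes rep: "simple_soc_rep m s n i j" and gcd: "Gcd (s ` {1..m}) = 1"
  shows "(\<Sum>l = 1..m. s l) \<le> 2 ^ n"
proof -
  define S where "S = (\<Sum>l = 1..m. s l)"
  have ij: "i k \<in> {1..m + n} \<and> j k \<in> {1..m + n}" if "k \<in> {1..n}" for k
    using rep that by (simp add: simple_soc_rep_def)
  obtain D :: int where D: "D \<noteq> 0" "\<bar>D\<bar> \<le> 2 ^ n"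
    and pot: "\<And>c. \<exists>P :: nat \<Rightarrow> int. (\<forall>v\<le>m. P v = D * c v) \<and>
          (\<forall>k\<in>{1..n}. 2 * P (m + k) = P (i k) + P (j k))"
    using integer_harmonic_potentials[of n i m j] ij by blast
  \<comment> \<open>Evaluate the weighted sum for the potential with value \<open>D\<close> at \<open>l\<close> and zero at the
    other boundary points.\<close>
  have "S dvd nat \<bar>D\<bar> * s l" if l: "l \<in> {1..m}" for l
  proof -
    obtain P :: "nat \<Rightarrow> int" where P: "\<And>v. v \<le> m \<Longrightarrow> P v = D * of_bool (v = l)"
      and harmonic: "\<And>k. k \<in> {1..n} \<Longrightarrow> 2 * P (m + k) = P (i k) + P (j k)"
      using pot[of "\<lambda>v. of_bool (v = l)"] by blast
    have "(\<Sum>v = 1..m. real (s v) * real_of_int (P v)) = real S * real_of_int (P (m + 1))"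
      unfolding S_def
      by (rule harmonic_potential_weighted_sum[OF rep])
        (metis harmonic of_int_add of_int_mult of_int_numeral)
    also have "(\<Sum>v = 1..m. real (s v) * real_of_int (P v))
        = (\<Sum>v = 1..m. if v = l then real (s v) * real_of_int D else 0)"
      by (rule sum.cong) (auto simp: P)
    also have "\<dots> = real (s l) * real_of_int D"
      using l by simp
    finally have "real_of_int (int (s l) * D) = real_of_int (int S * P (m + 1))" by simp
    then have "int (s l) * D = int S * P (m + 1)" by (simp only: of_int_eq_iff)
    then have "int S dvd int (s l) * \<bar>D\<bar>" by (metis dvd_triv_left abs_mult abs_of_nat)
    then have "int S dvd int (nat \<bar>D\<bar> * s l)" by (simp add: mult.commute)
    then show ?thesis by (simp only: int_dvd_int_iff)
  qed
  then have "S dvd Gcd ((*) (nat \<bar>D\<bar>) ` s ` {1..m})"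
    by (intro Gcd_greatest) auto
  then have "S dvd nat \<bar>D\<bar>" by (simp only: Gcd_mult gcd) simp
  then have "S \<le> nat \<bar>D\<bar>" using D by (intro dvd_imp_le) auto
  also have "\<dots> \<le> 2 ^ n" using D by (simp add: nat_le_iff)
  finally show ?thesis by (simp add: S_def)
qed

section \<open>Existence of representations\<close>

text \<open>
  The nodes of a complete binary tree of depth \<open>d\<close> are numbered as in a heap: the root is \<open>1\<close>, the
  children of \<open>k\<close> are \<open>2 * k\<close> and \<open>2 * k + 1\<close>, and the leaves are \<open>2 ^ d, \<dots>, 2 ^ Suc d - 1\<close>. Every inner
  node carries the geometric mean of its children. The index \<open>0\<close> is no node; it is treated like a
  leaf because it is its own left child.
\<close>

function heap_mean :: "nat \<Rightarrow> (nat \<Rightarrow> real) \<Rightarrow> nat \<Rightarrow> real" where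
  "heap_mean d a k = (if k = 0 \<or> 2 ^ d \<le> k then a k
     else sqrt (heap_mean d a (2 * k) * heap_mean d a (2 * k + 1)))"
  by pat_completeness auto
termination by (relation "measure (\<lambda>(d, a, k). 2 ^ d - k)") auto

declare heap_mean.simps [simp del]

lemma heap_mean_nonneg:
  assumes "\<And>k. 0 \<le> a k"
  shows "0 \<le> heap_mean d a k"
  using assms by (induction d a k rule: heap_mean.induct) (subst heap_mean.simps, simp)

lemma heap_mean_node:
  assumes "\<And>k. 0 \<le> a k" and "1 \<le> k" "k < 2 ^ d"
  shows "(heap_mean d a k)\<^sup>2 = heap_mean d a (2 * k) * heap_mean d a (2 * k + 1)"
  using assms heap_mean_nonneg[OF assms(1)] by (subst heap_mean.simps) simp

text \<open>
  Among the assignments that satisfy the quadratic constraints and have given leaves, the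
  geometric means are the largest at every node.
\<close>

lemma le_heap_mean:
  assumes "\<And>k. 0 \<le> a k"
    and "\<And>k. 1 \<le> k \<Longrightarrow> k < 2 ^ d \<Longrightarrow> (a k)\<^sup>2 \<le> a (2 * k) * a (2 * k + 1)"
  shows "a k \<le> heap_mean d a k"
  using assms
proof (induction d a k rule: heap_mean.induct)
  case (1 d a k)
  show ?case
  proof (cases "k = 0 \<or> 2 ^ d \<le> k")
    case True
    then show ?thesis by (subst heap_mean.simps) simp
  next
    case False
    have "(a k)\<^sup>2 \<le> a (2 * k) * a (2 * k + 1)" using False 1 by simp
    also have "\<dots> \<le> heap_mean d a (2 * k) * heap_mean d a (2 * k + 1)"
      using 1 False by (intro mult_mono heap_mean_nonneg) auto
    also have "\<dots> = (heap_mean d a k)\<^sup>2" using False 1 by (simp add: heap_mean_node)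
    finally show ?thesis by (rule power2_le_imp_le) (rule heap_mean_nonneg[OF 1(3)])
  qed
qed

lemma prod_siblings:
  fixes y :: "nat \<Rightarrow> 'a :: comm_monoid_mult"
  assumes "a \<le> b"
  shows "(\<Prod>k = a..<b. y (2 * k) * y (2 * k + 1)) = prod y {2 * a..<2 * b}"
  using assms by (induction rule: dec_induct) (simp_all add: algebra_simps)

text \<open>
  Squaring the product over one level of the tree gives the product over the next, so the
  product over level \<open>e\<close> is the root to the power \<open>2 ^ e\<close>.
\<close>

lemma heap_mean_root:
  assumes a: "\<And>k. 0 \<le> a k"
  shows "heap_mean d a 1 ^ 2 ^ d = prod a {2 ^ d..<2 ^ Suc d}"
proof -
  let ?y = "heap_mean d a"
  have "?y 1 ^ 2 ^ e = prod ?y {2 ^ e..<2 ^ Suc e}" if "e \<le> d" for e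
    using that
  proof (induction e)
    case 0
    have "{Suc 0..<2} = {1}" by auto
    then show ?case by simp
  next
    case (Suc e)
    have "?y 1 ^ 2 ^ Suc e = (?y 1 ^ 2 ^ e)\<^sup>2" by (simp flip: power_mult add: mult.commute)
    also have "\<dots> = (\<Prod>k = 2 ^ e..<2 ^ Suc e. (?y k)\<^sup>2)" using Suc by (simp add: prod_power_distrib)
    also have "\<dots> = (\<Prod>k = 2 ^ e..<2 ^ Suc e. ?y (2 * k) * ?y (2 * k + 1))"
    proof (intro prod.cong refl)
      fix k :: nat assume k: "k \<in> {2 ^ e..<2 ^ Suc e}"
      have "(2::nat) ^ Suc e \<le> 2 ^ d" using Suc.prems by (intro power_increasing) auto
      moreover have "(1::nat) \<le> 2 ^ e" by simp
      ultimately have "1 \<le> k" "k < 2 ^ d" using k unfolding atLeastLessThan_iff by linarith+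
      then show "(?y k)\<^sup>2 = ?y (2 * k) * ?y (2 * k + 1)" by (rule heap_mean_node[OF a])
    qed
    also have "\<dots> = prod ?y {2 ^ Suc e..<2 ^ Suc (Suc e)}"
      using prod_siblings[of "2 ^ e" "2 ^ Suc e" ?y] by simp
    finally show ?case .
  qed
  then have "?y 1 ^ 2 ^ d = prod ?y {2 ^ d..<2 ^ Suc d}" by blast
  also have "\<dots> = prod a {2 ^ d..<2 ^ Suc d}"
    by (intro prod.cong) (auto simp: heap_mean.simps)
  finally show ?thesis .
qed

lemma prod_list_eq_prod_nth: "prod_list (map x L) = (\<Prod>k<length L. x (L ! k))"
  for x :: "'b \<Rightarrow> 'a :: comm_monoid_mult"
  by (induction L) (simp_all add: prod.lessThan_Suc_shift del: prod.lessThan_Suc)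

text \<open>
  The leaves carry each \<open>x l\<close> with multiplicity \<open>s l\<close> and are padded with copies of \<open>x (m + 1)\<close>, which
  is also the root; the inner node \<open>k\<close> is the variable \<open>m + k\<close>. By \<open>le_heap_mean\<close> and
  \<open>heap_mean_root\<close>, auxiliary values exist iff \<open>x (m + 1) ^ 2 ^ d\<close> is at most the product of the leaves, which is the
  weighted inequality times \<open>x (m + 1) ^ (2 ^ d - S)\<close>. Cancelling this factor needs
  \<open>x (m + 1) > 0\<close>; at zero the weighted inequality is trivial since \<open>S > 0\<close>.
\<close>

lemma simple_soc_rep_exists:
  assumes pos: "0 < (\<Sum>l = 1..m. s l)"
  shows "\<exists>n i j. simple_soc_rep m s n i j"
proof -
  define S where "S = (\<Sum>l = 1..m. s l)"
  obtain d where d: "0 < d" "S < 2 ^ d" using assms less_exp unfolding S_def by blast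
  define L where "L = concat (map (\<lambda>l. replicate (s l) l) [1..<Suc m]) @ replicate (2 ^ d - S) (m + 1)"
  have len: "length L = 2 ^ d"
    using d by (simp add: L_def length_concat S_def comp_def sum_list_distinct_conv_sum_set
        atLeastLessThanSuc_atLeastAtMost del: upt_Suc)
  have prod_L: "prod_list (map x L) = (\<Prod>l = 1..m. x l ^ s l) * x (m + 1) ^ (2 ^ d - S)"
    for x :: "nat \<Rightarrow> real"
  proof -
    have "prod_list (map x (concat (map (\<lambda>l. replicate (s l) l) ls))) = (\<Prod>l\<leftarrow>ls. x l ^ s l)" for ls
      by (induction ls) (simp_all add: prod_list_replicate)
    then show ?thesis
      by (simp add: L_def prod_list_replicate prod.distinct_set_conv_list[symmetric]
        atLeastLessThanSuc_atLeastAtMost del: upt_Suc)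
  qed
  define var where "var c = (if c < 2 ^ d then m + c else L ! (c - 2 ^ d))" for c
  have leaf: "var c \<in> {1..m + 1}" if "2 ^ d \<le> c" "c < 2 ^ Suc d" for c
  proof -
    have "var c \<in> set L" using that len by (simp add: var_def)
    then show ?thesis by (auto simp: L_def)
  qed
  have leaves: "(\<Prod>c = 2 ^ d..<2 ^ Suc d. x (var c)) = (\<Prod>l = 1..m. x l ^ s l) * x (m + 1) ^ (2 ^ d - S)"
    for x :: "nat \<Rightarrow> real"
  proof -
    have "(\<Prod>c = 2 ^ d..<2 ^ Suc d. x (var c)) = (\<Prod>k = 0..<2 ^ d. x (L ! k))"
      using prod.shift_bounds_nat_ivl[of "\<lambda>c. x (var c)" 0 "2 ^ d" "2 ^ d"]
      by (simp add: var_def mult_2)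
    also have "\<dots> = prod_list (map x L)" by (simp add: prod_list_eq_prod_nth len atLeast0LessThan)
    finally show ?thesis by (simp only: prod_L)
  qed
  define n :: nat where "n = 2 ^ d - 1"
  have n: "1 \<le> k \<and> k < 2 ^ d" if "k \<in> {1..n}" for k
    using that unfolding n_def atLeastAtMost_iff by linarith
  have "(1::nat) < 2 ^ d" using d by (intro one_less_power) auto
  then have n_pos: "1 \<le> n" and var_1: "var 1 = m + 1" by (simp_all add: n_def var_def)
  have split: "x ^ S * x ^ (2 ^ d - S) = x ^ 2 ^ d" for x :: real
    using d by (simp flip: power_add)
  have "simple_soc_rep m s n (\<lambda>k. var (2 * k)) (\<lambda>k. var (2 * k + 1))"
    unfolding simple_soc_rep_def S_def[symmetric]
  proof (intro conjI ballI allI impI iffI)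
    show "1 \<le> n" by (rule n_pos)
  next
    have var: "var c \<in> {1..m + n}" if "1 \<le> c" "c < 2 ^ Suc d" for c
    proof (cases "c < 2 ^ d")
      case True
      then show ?thesis using that by (simp add: var_def n_def)
    next
      case False
      then show ?thesis using leaf[of c] False that n_pos by auto
    qed
    then show "var (2 * k) \<in> {1..m + n}" "var (2 * k + 1) \<in> {1..m + n}" if "k \<in> {1..n}" for k
      using n[OF that] by (intro var; simp)+
  next
    fix x :: "nat \<Rightarrow> real"
    assume x: "\<forall>l\<in>{1..m + 1}. 0 \<le> x l" and ineq: "x (m + 1) ^ S \<le> (\<Prod>l = 1..m. x l ^ s l)"
    define a where "a c = (if 2 ^ d \<le> c \<and> c < 2 ^ Suc d then x (var c) else 0)" for c
    define h where "h = heap_mean d a"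
    have a: "0 \<le> a c" for c using leaf[of c] x by (auto simp: a_def)
    have "x (m + 1) ^ 2 ^ d \<le> (\<Prod>l = 1..m. x l ^ s l) * x (m + 1) ^ (2 ^ d - S)"
      unfolding split[symmetric] using ineq x by (intro mult_right_mono) auto
    also have "\<dots> = h 1 ^ 2 ^ d"
      unfolding h_def heap_mean_root[OF a] leaves[symmetric] by (intro prod.cong) (auto simp: a_def)
    finally have root: "x (m + 1) \<le> h 1"
      by (rule power_le_imp_le_base[of _ "2 ^ d - 1", simplified]) (simp add: h_def heap_mean_nonneg a)
    \<comment> \<open>The root keeps the given value, which may be smaller than the mean of the leaves.\<close>
    define y where "y v = (if v \<le> m + 1 then x v else h (v - m))" for v
    have y_var: "y (var c) = h c" if "2 \<le> c" "c < 2 ^ Suc d" for c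
    proof (cases "c < 2 ^ d")
      case True
      then show ?thesis using that by (simp add: y_def var_def)
    next
      case False
      then show ?thesis
        using that leaf[of c] by (simp add: y_def h_def heap_mean.simps a_def)
    qed
    have y_le: "0 \<le> y (m + k) \<and> y (m + k) \<le> h k" if "1 \<le> k" for k
      using that root x by (cases "k = 1") (auto simp: y_def h_def heap_mean_nonneg a)
    have "(y (m + k))\<^sup>2 \<le> y (var (2 * k)) * y (var (2 * k + 1))" if "k \<in> {1..n}" for k
    proof -
      have "(y (m + k))\<^sup>2 \<le> (h k)\<^sup>2" using y_le[of k] that by (intro power_mono) auto
      also have "\<dots> = h (2 * k) * h (2 * k + 1)"
        using n[OF that] heap_mean_node[OF a] by (simp add: h_def)
      also have "\<dots> = y (var (2 * k)) * y (var (2 * k + 1))"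
        using n[OF that] by (simp add: y_var)
      finally show ?thesis .
    qed
    moreover have "0 \<le> y l" if "l \<in> {m + 2..m + n}" for l
      using that by (simp add: y_def h_def heap_mean_nonneg a)
    ultimately show "\<exists>y. (\<forall>l\<in>{1..m + 1}. y l = x l) \<and> (\<forall>l\<in>{m + 2..m + n}. 0 \<le> y l) \<and>
        (\<forall>k\<in>{1..n}. (y (m + k))\<^sup>2 \<le> y (var (2 * k)) * y (var (2 * k + 1)))"
      by (intro exI[of _ y]) (auto simp: y_def)
  next
    fix x :: "nat \<Rightarrow> real"
    assume x: "\<forall>l\<in>{1..m + 1}. 0 \<le> x l" and "\<exists>y. (\<forall>l\<in>{1..m + 1}. y l = x l) \<and>
        (\<forall>l\<in>{m + 2..m + n}. 0 \<le> y l) \<and>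
        (\<forall>k\<in>{1..n}. (y (m + k))\<^sup>2 \<le> y (var (2 * k)) * y (var (2 * k + 1)))"
    then obtain y where y: "\<And>l. l \<in> {1..m + 1} \<Longrightarrow> y l = x l" "\<And>l. l \<in> {m + 2..m + n} \<Longrightarrow> 0 \<le> y l"
      and soc: "\<And>k. k \<in> {1..n} \<Longrightarrow> (y (m + k))\<^sup>2 \<le> y (var (2 * k)) * y (var (2 * k + 1))"
      by blast
    define z where "z c = (if 1 \<le> c \<and> c < 2 ^ Suc d then y (var c) else 0)" for c
    have "(1::nat) < 2 ^ Suc d" by (rule one_less_power) auto
    then have z_1: "z 1 = x (m + 1)" using y(1)[of "m + 1"] var_1 by (simp add: z_def)
    have z: "0 \<le> z c" for c
    proof -
      consider "c = 0 \<or> 2 ^ Suc d \<le> c" | "c = 1" | "2 \<le> c" "c < 2 ^ d"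
        | "2 ^ d \<le> c" "c < 2 ^ Suc d" by linarith
      then show ?thesis
      proof cases
        case 1 then show ?thesis by (auto simp: z_def)
      next
        case 2 then show ?thesis using x z_1 by simp
      next
        case 3 then show ?thesis using y(2)[of "m + c"] by (simp add: z_def var_def n_def)
      next
        case 4 then show ?thesis using leaf[of c] x y(1)[of "var c"] by (simp add: z_def)
      qed
    qed
    have node: "(z k)\<^sup>2 \<le> z (2 * k) * z (2 * k + 1)" if "1 \<le> k" "k < 2 ^ d" for k
    proof -
      have "k \<in> {1..n}" using that by (auto simp: n_def)
      moreover have "var k = m + k" using that by (simp add: var_def)
      ultimately show ?thesis using soc[of k] that by (simp add: z_def)
    qed
    have "x (m + 1) = z 1" by (simp only: z_1)
    also have "\<dots> \<le> heap_mean d z 1" by (rule le_heap_mean[OF z node])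
    finally have "x (m + 1) ^ 2 ^ d \<le> heap_mean d z 1 ^ 2 ^ d"
      using x by (intro power_mono) auto
    also have "\<dots> = (\<Prod>c = 2 ^ d..<2 ^ Suc d. x (var c))"
      unfolding heap_mean_root[OF z]
    proof (intro prod.cong refl)
      fix c :: nat assume c: "c \<in> {2 ^ d..<2 ^ Suc d}"
      moreover have "(1::nat) \<le> 2 ^ d" by simp
      ultimately have "1 \<le> c" unfolding atLeastLessThan_iff by linarith
      then show "z c = x (var c)" using c leaf[of c] y(1)[of "var c"] by (simp add: z_def)
    qed
    finally have *: "x (m + 1) ^ S * x (m + 1) ^ (2 ^ d - S)
        \<le> (\<Prod>l = 1..m. x l ^ s l) * x (m + 1) ^ (2 ^ d - S)"
      unfolding leaves split .
    show "x (m + 1) ^ S \<le> (\<Prod>l = 1..m. x l ^ s l)"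
    proof (cases "x (m + 1) = 0")
      case True
      have "0 \<le> (\<Prod>l = 1..m. x l ^ s l)" using x by (intro prod_nonneg) auto
      then show ?thesis using True pos[folded S_def] by (simp add: zero_power)
    next
      case False
      moreover have "0 \<le> x (m + 1)" using x by simp
      ultimately have "0 < x (m + 1)" by linarith
      then show ?thesis by (intro mult_right_le_imp_le[OF *] zero_less_power)
    qed
  qed
  then show ?thesis by blast
qed

theorem corollary12:
  fixes m :: nat and s :: "nat \<Rightarrow> nat"
  assumes "1 \<le> m"
    and "\<And>l. l \<in> {1..m} \<Longrightarrow> 1 \<le> s l"
    and "Gcd (s ` {1..m}) = 1"
  shows "int (min_soc_size m s) \<ge> \<lceil>log 2 (real (\<Sum>l = 1..m. s l))\<rceil>"
proof -
  define S where "S = (\<Sum>l = 1..m. s l)"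
  have "s 1 \<le> S" using assms(1) by (auto simp: S_def intro!: member_le_sum)
  then have S: "0 < S" using assms(1) assms(2)[of 1] by simp
  then have "\<exists>n i j. simple_soc_rep m s n i j"
    unfolding S_def by (rule simple_soc_rep_exists)
  then have "\<exists>i j. simple_soc_rep m s (min_soc_size m s) i j"
    unfolding min_soc_size_def by (rule LeastI_ex)
  then have "S \<le> 2 ^ min_soc_size m s"
    unfolding S_def using sum_weights_le_power_size assms(3) by blast
  then have "real S \<le> 2 ^ min_soc_size m s" by (metis of_nat_le_iff of_nat_numeral of_nat_power)
  then have "log 2 (real S) \<le> log 2 (2 ^ min_soc_size m s)"
    using S by (subst log_le_cancel_iff) auto
  also have "\<dots> = real (min_soc_size m s)" by (subst log_nat_power) auto
  finally show ?thesis unfolding S_def by (subst ceiling_le_iff) simp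
qed

end
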